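(* Let $k\ge 2$ and let $A=(A_1,A_2,A_3,A_4)$ be a tuple of elements of the Banach algebra $M_k(\mathbb{C})$. Let $A(z)=z_1A_1+z_2A_2+z_3A_3+z_4A_4$, let $P^c(A)=\{z\in\mathbb{C}^4: A(z)\text{ is invertible}\}$, and let $\omega_A(z)=A(z)^{-1}dA(z)$. Then there is a function $p(z)$, homogeneous of degree $2k-4$, such that on $P^c(A)$ $$\mathrm{tr}(\omega_A^3)=\frac{3p(z)}{\det^2(A(z))}\cdot s(z),$$ where $$s(z)=-z_1\,dz_2\wedge dz_3\wedge dz_4+z_2\,dz_1\wedge dz_3\wedge dz_4-z_3\,dz_1\wedge dz_2\wedge dz_4+z_4\,dz_1\wedge dz_2\wedge dz_3.$$
   Context: $M_k(\mathbb{C})$ is the algebra of complex $k\times k$ matrices and $\mathrm{tr}$ is the usual matrix trace. Here $\omega_A=\sum_{i=1}^4 A(z)^{-1}A_i\,dz_i$ is a matrix-valued holomorphic 1-form on $P^c(A)$, $\omega_A^3=\omega_A\wedge\omega_A\wedge\omega_A$ is formed with matrix multiplication of coefficients, and $\mathrm{tr}(\omega_A^3)=\sum_{i,j,l}\mathrm{tr}\big(A(z)^{-1}A_iA(z)^{-1}A_jA(z)^{-1}A_l\big)\,dz_i\wedge dz_j\wedge dz_l$. $\det^2(A(z))$ means $(\det A(z))^2$. *)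

theory Defs
  imports "HOL-Analysis.Analysis" "HOL-Combinatorics.Permutations"
begin

text \<open>
  The index type \<^typ>\<open>4\<close> has the elements 1, 2, 3, 4 (with \<open>4 = 0\<close>); likewise for \<^typ>\<open>3\<close>.
  On \<^typ>\<open>complex^'k^'k\<close> the product \<open>*\<close> is entrywise; the algebra product is \<open>**\<close>.
\<close>

definition mat_scale :: "'a::times \<Rightarrow> 'a^'n^'m \<Rightarrow> 'a^'n^'m" where
  "mat_scale c M = (\<chi> i j. c * M $ i $ j)"

definition pencil :: "(4 \<Rightarrow> complex^'k^'k) \<Rightarrow> complex^4 \<Rightarrow> complex^'k^'k" where
  "pencil A z = (\<Sum>i\<in>UNIV. mat_scale (z $ i) (A i))"

definition projective_resolvent :: "(4 \<Rightarrow> complex^'k^'k) \<Rightarrow> (complex^4) set" where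
  "projective_resolvent A = {z. invertible (pencil A z)}"

text \<open>
  The value of a 1-form at a point is a function of one tangent vector, and the value of a 3-form
  at a point is a function of three tangent vectors, indexed by the type \<^typ>\<open>3\<close>.
  The wedge product carries no factor \<open>1/3!\<close>, so that
  \<open>dz\<^sub>i \<and> dz\<^sub>j \<and> dz\<^sub>l\<close> is the determinant of the coordinates \<open>i, j, l\<close> of the three vectors.
  The coefficients are multiplied by \<open>m\<close>, in the order of the factors.
\<close>

definition dz :: "4 \<Rightarrow> complex^4 \<Rightarrow> complex" where
  "dz i v = v $ i"

definition wedge3 ::
    "('a \<Rightarrow> 'a \<Rightarrow> 'a) \<Rightarrow> ('v \<Rightarrow> 'a) \<Rightarrow> ('v \<Rightarrow> 'a) \<Rightarrow> ('v \<Rightarrow> 'a) \<Rightarrow> (3 \<Rightarrow> 'v) \<Rightarrow> 'a::real_vector"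
  where
  "wedge3 m \<alpha> \<beta> \<gamma> v =
     (\<Sum>\<sigma> | \<sigma> permutes UNIV. of_int (sign \<sigma>) *\<^sub>R m (m (\<alpha> (v (\<sigma> 1))) (\<beta> (v (\<sigma> 2)))) (\<gamma> (v (\<sigma> 3))))"

definition omega :: "(4 \<Rightarrow> complex^'k^'k) \<Rightarrow> complex^4 \<Rightarrow> complex^4 \<Rightarrow> complex^'k^'k" where
  "omega A z v = (\<Sum>i\<in>UNIV. mat_scale (dz i v) (matrix_inv (pencil A z) ** A i))"

definition omega_cubed :: "(4 \<Rightarrow> complex^'k^'k) \<Rightarrow> complex^4 \<Rightarrow> (3 \<Rightarrow> complex^4) \<Rightarrow> complex^'k^'k"
  where
  "omega_cubed A z = wedge3 (**) (omega A z) (omega A z) (omega A z)"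

definition tr_omega_cubed :: "(4 \<Rightarrow> complex^'k^'k) \<Rightarrow> complex^4 \<Rightarrow> (3 \<Rightarrow> complex^4) \<Rightarrow> complex" where
  "tr_omega_cubed A z v = trace (omega_cubed A z v)"

definition s_form :: "complex^4 \<Rightarrow> (3 \<Rightarrow> complex^4) \<Rightarrow> complex" where
  "s_form z v =
     - (z $ 1) * wedge3 (*) (dz 2) (dz 3) (dz 4) v
     + z $ 2 * wedge3 (*) (dz 1) (dz 3) (dz 4) v
     - z $ 3 * wedge3 (*) (dz 1) (dz 2) (dz 4) v
     + z $ 4 * wedge3 (*) (dz 1) (dz 2) (dz 3) v"

text \<open>
  The scalar is nonzero so that degree 0 does not compare \<open>p z\<close> with the value at the origin.
\<close>

definition homogeneous_of_degree :: "nat \<Rightarrow> (complex^'n \<Rightarrow> complex) \<Rightarrow> bool" where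
  "homogeneous_of_degree d p \<longleftrightarrow> (\<forall>c z. c \<noteq> 0 \<longrightarrow> p (c *s z) = c ^ d * p z)"

text \<open>The following facts relate \<open>omega\<close> to \<open>A(z)\<^sup>-\<^sup>1 dA(z)\<close> and give \<open>tr(\<omega>\<^sup>3)\<close> in coordinates.\<close>

lemma matrix_mult_sum_left: "(\<Sum>i\<in>S. f i) ** (M :: 'a::semiring_1^'n^'p) = (\<Sum>i\<in>S. f i ** M)"
  by (simp add: vec_eq_iff matrix_matrix_mult_def sum_component sum_distrib_right sum.swap[of _ S])

lemma matrix_mult_sum_right: "(M :: 'a::semiring_1^'n^'p) ** (\<Sum>i\<in>S. f i) = (\<Sum>i\<in>S. M ** f i)"
  by (simp add: vec_eq_iff matrix_matrix_mult_def sum_component sum_distrib_left sum.swap[of _ S])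

lemma matrix_mult_sum3:
  fixes f g h :: "'i \<Rightarrow> 'a::semiring_1^'n^'n"
  shows "(\<Sum>i\<in>S. f i) ** (\<Sum>j\<in>S. g j) ** (\<Sum>l\<in>S. h l) =
    (\<Sum>i\<in>S. \<Sum>j\<in>S. \<Sum>l\<in>S. f i ** g j ** h l)"
proof -
  have "f i ** (\<Sum>j\<in>S. g j) ** (\<Sum>l\<in>S. h l) = (\<Sum>j\<in>S. \<Sum>l\<in>S. f i ** g j ** h l)" for i
    unfolding matrix_mult_sum_right[of "f i"] unfolding matrix_mult_sum_left
    unfolding matrix_mult_sum_right ..
  then show ?thesis
    by (simp only: matrix_mult_sum_left)
qed

lemma mat_scale_mult_left:
  "mat_scale c (M :: 'a::comm_semiring_1^'n^'m) ** (N :: 'a^'p^'n) = mat_scale c (M ** N)"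
  by (simp add: mat_scale_def matrix_matrix_mult_def vec_eq_iff sum_distrib_left mult.assoc)

lemma mat_scale_mult_right:
  "(M :: 'a::comm_semiring_1^'n^'m) ** mat_scale c (N :: 'a^'p^'n) = mat_scale c (M ** N)"
  by (simp add: mat_scale_def matrix_matrix_mult_def vec_eq_iff sum_distrib_left mult_ac)

lemma trace_sum: "trace (\<Sum>i\<in>S. f i :: 'a::comm_semiring_1^'n^'n) = (\<Sum>i\<in>S. trace (f i))"
  by (simp add: trace_def sum.swap[of _ S])

lemma trace_mat_scale: "trace (mat_scale c (M :: 'a::comm_semiring_1^'n^'n)) = c * trace M"
  by (simp add: trace_def mat_scale_def sum_distrib_left)

lemma trace_scaleR: "trace (r *\<^sub>R M) = r *\<^sub>R trace (M :: complex^'n^'n)"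
  by (simp add: trace_def scaleR_sum_right)

lemma linear_pencil: "linear (pencil A)"
  by (rule linearI)
    (auto simp: pencil_def mat_scale_def vec_eq_iff algebra_simps sum.distrib scaleR_sum_right)

lemma has_derivative_pencil: "(pencil A has_derivative pencil A) (at z)"
  by (simp add: bounded_linear_imp_has_derivative linear_pencil linear_conv_bounded_linear[symmetric])

lemma omega_eq: "omega A z v = matrix_inv (pencil A z) ** frechet_derivative (pencil A) (at z) v"
proof -
  have "frechet_derivative (pencil A) (at z) = pencil A"
    using frechet_derivative_at[OF has_derivative_pencil] by metis
  then show ?thesis
    by (simp add: omega_def dz_def pencil_def[of A v] matrix_mult_sum_right mat_scale_mult_right)
qed

lemma tr_omega_cubed_eq:
  fixes A :: "4 \<Rightarrow> complex^'k^'k"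
  defines "B \<equiv> \<lambda>z i. matrix_inv (pencil A z) ** A i"
  shows "tr_omega_cubed A z v =
    (\<Sum>i\<in>UNIV. \<Sum>j\<in>UNIV. \<Sum>l\<in>UNIV.
      trace (B z i ** B z j ** B z l) * wedge3 (*) (dz i) (dz j) (dz l) v)"
proof -
  have *: "trace (omega A z a ** omega A z b ** omega A z c) =
      (\<Sum>i\<in>UNIV. \<Sum>j\<in>UNIV. \<Sum>l\<in>UNIV. dz i a * dz j b * dz l c * trace (B z i ** B z j ** B z l))"
    for a b c
    unfolding omega_def matrix_mult_sum3
    by (simp add: B_def mat_scale_mult_left mat_scale_mult_right trace_sum trace_mat_scale mult_ac)
  show ?thesis
    unfolding tr_omega_cubed_def omega_cubed_def wedge3_def
    by (simp add: trace_sum trace_scaleR * sum_distrib_left scaleR_sum_right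
        sum.swap[of _ _ "{\<sigma>. \<sigma> permutes UNIV}"] mult_ac)
qed

end

theory Submission
  imports Defs
begin

text \<open>
  Write \<open>B\<^sub>i = A(z)\<^sup>-\<^sup>1 A\<^sub>i\<close> and \<open>t\<^sub>i\<^sub>j\<^sub>l = tr (B\<^sub>i B\<^sub>j B\<^sub>l)\<close>.
  Since the trace is cyclic, the six permutations of a triple \<open>i, j, l\<close> fall into two classes of
  three, so the coefficient of \<open>dz\<^sub>i \<and> dz\<^sub>j \<and> dz\<^sub>l\<close> (\<open>i < j < l\<close>) in \<open>tr(\<omega>\<^sup>3)\<close> is
  \<open>3 c\<^sub>i\<^sub>j\<^sub>l\<close> with \<open>c\<^sub>i\<^sub>j\<^sub>l = t\<^sub>i\<^sub>j\<^sub>l - t\<^sub>i\<^sub>l\<^sub>j\<close>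
  (\<open>sum_cyclic_times_alternating\<close>). This is the origin of the factor 3.

  The radial direction annihilates the form: \<open>\<omega>(z)\<close> is the identity matrix in the direction \<open>z\<close>,
  because \<open>\<Sum>\<^sub>i z\<^sub>i A\<^sub>i = A(z)\<close>, hence
  \<open>\<Sum>\<^sub>i z\<^sub>i c\<^sub>i\<^sub>j\<^sub>l = tr (B\<^sub>j B\<^sub>l) - tr (B\<^sub>l B\<^sub>j) = 0\<close> (\<open>radial_contraction\<close>). On a four-dimensional
  space the alternating 3-forms annihilated by a vector \<open>z \<noteq> 0\<close> form a line, which is spanned by \<open>s(z)\<close>, the
  contraction of the volume form with \<open>-z\<close>. In coordinates, the vector \<open>a\<close> of the
  \<open>c\<^sub>i\<^sub>j\<^sub>l\<close> with alternating signs is parallel to \<open>z\<close>, and so \<open>a = q z\<close> for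
  \<open>q = \<langle>a, z\<rangle> / \<langle>z, z\<rangle>\<close> and \<open>tr(\<omega>\<^sup>3) = 3 q s(z)\<close>.

  Finally \<open>p = q det\<^sup>2 A(z)\<close>. Each \<open>B\<^sub>i\<close> has degree \<open>-1\<close> in \<open>z\<close>, so \<open>a\<close> has degree \<open>-3\<close>
  and \<open>q\<close> degree \<open>-4\<close>, while \<open>det\<^sup>2 A(z)\<close> has degree \<open>2k\<close>. Together this gives \<open>2k - 4\<close>.
\<close>

section \<open>Alternating sums and parallel vectors\<close>

text \<open>
  The value is the minor of the rows \<open>i, j, l\<close> of the matrix whose columns are the tangent vectors;
  the sum over \<open>\<sigma>\<close> is the Leibniz formula for it.
\<close>

lemma wedge3_dz:
  "wedge3 (*) (dz i) (dz j) (dz l) v =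
     v 1 $ i * v 2 $ j * v 3 $ l + v 2 $ i * v 3 $ j * v 1 $ l + v 3 $ i * v 1 $ j * v 2 $ l
     - v 1 $ i * v 3 $ j * v 2 $ l - v 2 $ i * v 1 $ j * v 3 $ l - v 3 $ i * v 2 $ j * v 1 $ l"
proof -
  define M :: "complex^3^3" where
    "M = vector [\<chi> c. v c $ i, \<chi> c. v c $ j, \<chi> c. v c $ l]"
  have M: "M $ 1 $ c = v c $ i" "M $ 2 $ c = v c $ j" "M $ 3 $ c = v c $ l" for c
    by (simp_all add: M_def vector_3)
  have prod3: "prod f UNIV = f 1 * f 2 * f 3" for f :: "3 \<Rightarrow> complex"
    unfolding UNIV_3 by (simp add: mult.assoc)
  have "wedge3 (*) (dz i) (dz j) (dz l) v = det M"
    unfolding wedge3_def det_def dz_def prod3 M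
    by (simp only: scaleR_conv_of_real of_real_of_int_eq)
  also have "\<dots> = v 1 $ i * v 2 $ j * v 3 $ l + v 2 $ i * v 3 $ j * v 1 $ l + v 3 $ i * v 1 $ j * v 2 $ l
     - v 1 $ i * v 3 $ j * v 2 $ l - v 2 $ i * v 1 $ j * v 3 $ l - v 3 $ i * v 2 $ j * v 1 $ l"
    unfolding det_3 M by (simp only: mult_ac)
  finally show ?thesis .
qed

lemma wedge3_dz_swap:
  "wedge3 (*) (dz j) (dz i) (dz l) v = - wedge3 (*) (dz i) (dz j) (dz l) v"
  "wedge3 (*) (dz i) (dz l) (dz j) v = - wedge3 (*) (dz i) (dz j) (dz l) v"
  unfolding wedge3_dz by algebra+

text \<open>
  Even permutations of a triple are cyclic, so all three of them contribute the same summand, and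
  likewise the three odd ones.
\<close>

lemma sum_cyclic_times_alternating:
  fixes t W :: "4 \<Rightarrow> 4 \<Rightarrow> 4 \<Rightarrow> complex"
  assumes cyc: "\<And>i j l. t j l i = t i j l"
    and swap12: "\<And>i j l. W j i l = - W i j l"
    and swap23: "\<And>i j l. W i l j = - W i j l"
  shows "(\<Sum>i\<in>UNIV. \<Sum>j\<in>UNIV. \<Sum>l\<in>UNIV. t i j l * W i j l) =
    3 * ((t 2 3 4 - t 2 4 3) * W 2 3 4 + (t 1 3 4 - t 1 4 3) * W 1 3 4
       + (t 1 2 4 - t 1 4 2) * W 1 2 4 + (t 1 2 3 - t 1 3 2) * W 1 2 3)"
proof -
  have W0: "W i i l = 0" "W i l l = 0" "W i l i = 0" for i l
  proof -
    have eq: "W i i l = 0" for i l using swap12[of i i l] by simp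
    show "W i i l = 0" by (rule eq)
    show "W i l l = 0" using swap23[of i l l] by simp
    show "W i l i = 0" using swap23[of i l i] eq[of i l] by simp
  qed
  have perm: "t i j l * W i j l + t i l j * W i l j + t j i l * W j i l
      + t j l i * W j l i + t l i j * W l i j + t l j i * W l j i
      = 3 * ((t i j l - t i l j) * W i j l)" for i j l
  proof -
    have "W i l j = - W i j l" "W j i l = - W i j l" "W j l i = W i j l" "W l i j = W i j l"
      "W l j i = - W i j l"
      using swap12[of i j l] swap23[of i j l] swap23[of j i l] swap12[of i l j] swap12[of j l i]
      by simp_all
    moreover have "t j l i = t i j l" "t l i j = t i j l" "t j i l = t i l j" "t l j i = t i l j"
      using cyc[of i j l] cyc[of j l i] cyc[of l j i] cyc[of i l j] by simp_all
    ultimately show ?thesis by (simp add: algebra_simps)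
  qed
  let ?S = "\<lambda>i j l. t i j l * W i j l + t i l j * W i l j + t j i l * W j i l
      + t j l i * W j l i + t l i j * W l i j + t l j i * W l j i"
  have "(\<Sum>i\<in>UNIV. \<Sum>j\<in>UNIV. \<Sum>l\<in>UNIV. t i j l * W i j l)
      = ?S 2 3 4 + ?S 1 3 4 + ?S 1 2 4 + ?S 1 2 3"
    by (simp only: sum_4 W0 mult_zero_right add_0_left add_0_right add_ac)
  then show ?thesis
    by (simp only: perm distrib_left)
qed

text \<open>
  The factor of proportionality is the orthogonal projection coefficient. A quotient of single
  coordinates would serve as well but would depend on the choice of a nonzero coordinate.
\<close>

lemma parallel_eq_scaled:
  fixes a z :: "complex^'n"
  assumes par: "\<And>i j. a $ i * z $ j = a $ j * z $ i" and "z \<noteq> 0"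
  shows "a $ i = (\<Sum>j\<in>UNIV. a $ j * cnj (z $ j)) / (\<Sum>j\<in>UNIV. z $ j * cnj (z $ j)) * z $ i"
proof -
  have "(\<Sum>j\<in>UNIV. z $ j * cnj (z $ j)) = of_real (\<Sum>j\<in>UNIV. (cmod (z $ j))\<^sup>2)"
    by (simp only: of_real_sum complex_norm_square)
  moreover have "(\<Sum>j\<in>UNIV. (cmod (z $ j))\<^sup>2) \<noteq> 0"
    using \<open>z \<noteq> 0\<close> by (simp add: sum_nonneg_eq_0_iff vec_eq_iff)
  ultimately have "(\<Sum>j\<in>UNIV. z $ j * cnj (z $ j)) \<noteq> 0"
    by (metis of_real_eq_0_iff)
  moreover have "(\<Sum>j\<in>UNIV. a $ j * cnj (z $ j)) * z $ i = a $ i * (\<Sum>j\<in>UNIV. z $ j * cnj (z $ j))"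
    unfolding sum_distrib_left sum_distrib_right
  proof (rule sum.cong[OF refl])
    fix j
    have "a $ j * cnj (z $ j) * z $ i = a $ j * z $ i * cnj (z $ j)"
      by (simp only: mult_ac)
    also have "\<dots> = a $ i * (z $ j * cnj (z $ j))"
      by (simp only: par[of j i] mult.assoc)
    finally show "a $ j * cnj (z $ j) * z $ i = a $ i * (z $ j * cnj (z $ j))" .
  qed
  ultimately show ?thesis
    by (simp add: divide_simps)
qed

section \<open>The pencil under scaling\<close>

lemma det_mat_scale: "det (mat_scale c M) = c ^ CARD('n) * det (M :: complex^'n^'n)"
proof -
  have "mat_scale c M = (\<chi> i. c *s M $ i)"
    by (simp add: mat_scale_def vec_eq_iff)
  then show ?thesis
    using det_rows_mul[of "\<lambda>_. c" "\<lambda>i. M $ i"] by simp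
qed

lemma pencil_scale: "pencil A (c *s z) = mat_scale c (pencil A z)"
  by (simp add: pencil_def mat_scale_def vec_eq_iff sum_distrib_left mult_ac)

lemma invertible_matrix_inv:
  fixes M :: "complex^'n^'n"
  assumes "invertible M"
  shows "M ** matrix_inv M = mat 1" and "matrix_inv M ** M = mat 1"
  using someI_ex[OF assms[unfolded invertible_def]] by (simp_all add: matrix_inv_def)

lemma matrix_inv_mat_scale:
  fixes M :: "complex^'n^'n"
  assumes "invertible M" and "c \<noteq> 0"
  shows "matrix_inv (mat_scale c M) = mat_scale (inverse c) (matrix_inv M)"
proof -
  let ?N = "mat_scale (inverse c) (matrix_inv M)"
  have cancel: "mat_scale (inverse c) (mat_scale c N) = N" for N :: "complex^'n^'n"
    using \<open>c \<noteq> 0\<close> by (simp add: mat_scale_def vec_eq_iff)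
  have right: "mat_scale c M ** ?N = mat 1"
    using \<open>invertible M\<close>
    by (simp add: mat_scale_mult_left mat_scale_mult_right invertible_matrix_inv cancel)
  then have "invertible (mat_scale c M)"
    using invertible_right_inverse by blast
  then have "matrix_inv (mat_scale c M) = matrix_inv (mat_scale c M) ** (mat_scale c M ** ?N)"
    by (simp add: right)
  also have "\<dots> = ?N"
    using invertible_matrix_inv(2)[OF \<open>invertible (mat_scale c M)\<close>]
    by (simp add: matrix_mul_assoc)
  finally show ?thesis .
qed

section \<open>The coefficients of the trace form\<close>

definition triple_trace :: "(4 \<Rightarrow> complex^'k^'k) \<Rightarrow> complex^4 \<Rightarrow> 4 \<Rightarrow> 4 \<Rightarrow> 4 \<Rightarrow> complex" where
  "triple_trace A z i j l =
     trace ((matrix_inv (pencil A z) ** A i) ** (matrix_inv (pencil A z) ** A j)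
       ** (matrix_inv (pencil A z) ** A l))"

definition alt_coeff :: "(4 \<Rightarrow> complex^'k^'k) \<Rightarrow> complex^4 \<Rightarrow> 4 \<Rightarrow> 4 \<Rightarrow> 4 \<Rightarrow> complex" where
  "alt_coeff A z i j l = triple_trace A z i j l - triple_trace A z i l j"

lemma triple_trace_cyclic: "triple_trace A z j l i = triple_trace A z i j l"
  using trace_mul_sym[of
      "(matrix_inv (pencil A z) ** A j) ** (matrix_inv (pencil A z) ** A l)"
      "matrix_inv (pencil A z) ** A i"]
  by (simp only: triple_trace_def matrix_mul_assoc)

lemma alt_coeff_swap:
  "alt_coeff A z j i l = - alt_coeff A z i j l"
  "alt_coeff A z i l j = - alt_coeff A z i j l"
proof -
  have "triple_trace A z j l i = triple_trace A z i j l"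
    "triple_trace A z i l j = triple_trace A z j i l"
    by (rule triple_trace_cyclic)+
  then show "alt_coeff A z j i l = - alt_coeff A z i j l"
    by (simp add: alt_coeff_def)
  show "alt_coeff A z i l j = - alt_coeff A z i j l"
    by (simp add: alt_coeff_def)
qed

lemma alt_coeff_rotate: "alt_coeff A z l i j = alt_coeff A z i j l"
proof -
  have "alt_coeff A z l i j = - alt_coeff A z i l j"
    by (rule alt_coeff_swap)
  also have "alt_coeff A z i l j = - alt_coeff A z i j l"
    by (rule alt_coeff_swap)
  finally show ?thesis by simp
qed

lemma alt_coeff_same: "alt_coeff A z i i l = 0" "alt_coeff A z i l i = 0" "alt_coeff A z l i i = 0"
  using alt_coeff_swap(1)[of A z i i l] alt_coeff_swap(1)[of A z i l i]
    alt_coeff_swap(2)[of A z i i l] alt_coeff_swap(2)[of A z l i i]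
  by simp_all

lemma triple_trace_scale:
  assumes "invertible (pencil A z)" and "c \<noteq> 0"
  shows "triple_trace A (c *s z) i j l = inverse c ^ 3 * triple_trace A z i j l"
  using assms
  by (simp add: triple_trace_def pencil_scale matrix_inv_mat_scale mat_scale_mult_left
      mat_scale_mult_right trace_mat_scale power3_eq_cube mult.assoc)

text \<open>
  The tangent vector \<open>z\<close> turns one factor \<open>\<omega>\<close> into the identity; what remains is the trace of a
  commutator.
\<close>

lemma radial_contraction:
  assumes "invertible (pencil A z)"
  shows "(\<Sum>i\<in>UNIV. z $ i * alt_coeff A z i j l) = 0"
proof -
  let ?B = "\<lambda>i. matrix_inv (pencil A z) ** A i"
  have id: "(\<Sum>i\<in>UNIV. mat_scale (z $ i) (?B i)) = mat 1"
    using invertible_matrix_inv(2)[OF assms]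
    by (simp add: pencil_def matrix_mult_sum_right mat_scale_mult_right)
  have "(\<Sum>i\<in>UNIV. z $ i * triple_trace A z i j l) = trace (?B j ** ?B l)" for j l
  proof -
    have "(\<Sum>i\<in>UNIV. z $ i * triple_trace A z i j l)
        = trace ((\<Sum>i\<in>UNIV. mat_scale (z $ i) (?B i)) ** (?B j ** ?B l))"
      by (simp only: triple_trace_def matrix_mult_sum_left mat_scale_mult_left trace_sum
          trace_mat_scale matrix_mul_assoc)
    then show ?thesis by (simp add: id)
  qed
  then show ?thesis
    by (simp add: alt_coeff_def right_diff_distrib sum_subtractf trace_mul_sym[of "?B j" "?B l"])
qed

text \<open>
  The signs are those of \<open>s(z)\<close>: the identity \<open>tr(\<omega>\<^sup>3) = 3 q s(z)\<close> says that this vector is \<open>q z\<close>.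
\<close>

definition dual_vec :: "(4 \<Rightarrow> complex^'k^'k) \<Rightarrow> complex^4 \<Rightarrow> complex^4" where
  "dual_vec A z =
     vector [- alt_coeff A z 2 3 4, alt_coeff A z 1 3 4, - alt_coeff A z 1 2 4, alt_coeff A z 1 2 3]"

lemma dual_vec_nth:
  "dual_vec A z $ 1 = - alt_coeff A z 2 3 4" "dual_vec A z $ 2 = alt_coeff A z 1 3 4"
  "dual_vec A z $ 3 = - alt_coeff A z 1 2 4" "dual_vec A z $ 4 = alt_coeff A z 1 2 3"
  by (simp_all add: dual_vec_def vector_def)

text \<open>
  For each of the six pairs \<open>j, l\<close> the radial contraction has only two nonzero summands; it states
  the proportionality of the two coordinates that are complementary to the pair.
\<close>

lemma dual_vec_parallel:
  assumes "invertible (pencil A z)"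
  shows "dual_vec A z $ i * z $ j = dual_vec A z $ j * z $ i"
proof -
  note contr = radial_contraction[OF assms, unfolded sum_4 alt_coeff_same]
  have sorted: "alt_coeff A z 2 1 3 = - alt_coeff A z 1 2 3" "alt_coeff A z 3 1 2 = alt_coeff A z 1 2 3"
    "alt_coeff A z 2 1 4 = - alt_coeff A z 1 2 4" "alt_coeff A z 4 1 2 = alt_coeff A z 1 2 4"
    "alt_coeff A z 3 1 4 = - alt_coeff A z 1 3 4" "alt_coeff A z 4 1 3 = alt_coeff A z 1 3 4"
    "alt_coeff A z 3 2 4 = - alt_coeff A z 2 3 4" "alt_coeff A z 4 2 3 = alt_coeff A z 2 3 4"
    by (rule alt_coeff_swap(1) alt_coeff_rotate)+
  have e12: "dual_vec A z $ 1 * z $ 2 = dual_vec A z $ 2 * z $ 1"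
    using contr[of 3 4] unfolding dual_vec_nth sorted alt_coeff_same by algebra
  have e13: "dual_vec A z $ 1 * z $ 3 = dual_vec A z $ 3 * z $ 1"
    using contr[of 2 4] unfolding dual_vec_nth sorted alt_coeff_same by algebra
  have e14: "dual_vec A z $ 1 * z $ 4 = dual_vec A z $ 4 * z $ 1"
    using contr[of 2 3] unfolding dual_vec_nth sorted alt_coeff_same by algebra
  have e23: "dual_vec A z $ 2 * z $ 3 = dual_vec A z $ 3 * z $ 2"
    using contr[of 1 4] unfolding dual_vec_nth sorted alt_coeff_same by algebra
  have e24: "dual_vec A z $ 2 * z $ 4 = dual_vec A z $ 4 * z $ 2"
    using contr[of 1 3] unfolding dual_vec_nth sorted alt_coeff_same by algebra
  have e34: "dual_vec A z $ 3 * z $ 4 = dual_vec A z $ 4 * z $ 3"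
    using contr[of 1 2] unfolding dual_vec_nth sorted alt_coeff_same by algebra
  have "\<forall>i j. dual_vec A z $ i * z $ j = dual_vec A z $ j * z $ i"
    by (simp add: forall_4 e12 e13 e14 e23 e24 e34)
  then show ?thesis by blast
qed

section \<open>The factor of proportionality\<close>

definition radial_factor :: "(4 \<Rightarrow> complex^'k^'k) \<Rightarrow> complex^4 \<Rightarrow> complex" where
  "radial_factor A z =
     (\<Sum>j\<in>UNIV. dual_vec A z $ j * cnj (z $ j)) / (\<Sum>j\<in>UNIV. z $ j * cnj (z $ j))"

lemma tr_omega_cubed_eq_radial_factor:
  assumes inv: "invertible (pencil A z)"
  shows "tr_omega_cubed A z v = 3 * radial_factor A z * s_form z v"
proof -
  let ?W = "\<lambda>i j l. wedge3 (*) (dz i) (dz j) (dz l) v"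
  have "z \<noteq> 0"
  proof
    assume "z = 0"
    then have "pencil A z = 0" by (simp add: linear_0 linear_pencil)
    also have "\<dots> = mat 0" by (simp add: mat_def vec_eq_iff)
    finally have "det (pencil A z) = 0" by (simp only: det_0)
    then show False using inv by (simp add: invertible_det_nz)
  qed
  then have q: "dual_vec A z $ i = radial_factor A z * z $ i" for i
    unfolding radial_factor_def by (intro parallel_eq_scaled dual_vec_parallel inv)
  have "tr_omega_cubed A z v = (\<Sum>i\<in>UNIV. \<Sum>j\<in>UNIV. \<Sum>l\<in>UNIV. triple_trace A z i j l * ?W i j l)"
    by (simp only: tr_omega_cubed_eq triple_trace_def)
  also have "\<dots> = 3 * (alt_coeff A z 2 3 4 * ?W 2 3 4 + alt_coeff A z 1 3 4 * ?W 1 3 4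
      + alt_coeff A z 1 2 4 * ?W 1 2 4 + alt_coeff A z 1 2 3 * ?W 1 2 3)"
    unfolding alt_coeff_def
    by (intro sum_cyclic_times_alternating triple_trace_cyclic wedge3_dz_swap)
  also have "\<dots> = 3 * (- dual_vec A z $ 1 * ?W 2 3 4 + dual_vec A z $ 2 * ?W 1 3 4
      - dual_vec A z $ 3 * ?W 1 2 4 + dual_vec A z $ 4 * ?W 1 2 3)"
    by (simp add: dual_vec_nth)
  also have "\<dots> = 3 * radial_factor A z * s_form z v"
    unfolding q s_form_def by (simp add: algebra_simps)
  finally show ?thesis .
qed

text \<open>
  The dual vector contributes degree \<open>-3\<close>, and the projection coefficient
  \<open>\<langle>a, z\<rangle> / \<langle>z, z\<rangle>\<close> is linear in \<open>a\<close> and of degree \<open>-1\<close> in \<open>z\<close>, since the conjugated scalars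
  cancel.
\<close>

lemma radial_factor_scale:
  assumes "invertible (pencil A z)" and "c \<noteq> 0"
  shows "radial_factor A (c *s z) = inverse c ^ 4 * radial_factor A z"
proof -
  have "dual_vec A (c *s z) $ j = inverse c ^ 3 * dual_vec A z $ j" for j
  proof -
    have "\<forall>j. dual_vec A (c *s z) $ j = inverse c ^ 3 * dual_vec A z $ j"
      by (simp add: forall_4 dual_vec_nth alt_coeff_def triple_trace_scale[OF assms]
          right_diff_distrib)
    then show ?thesis by blast
  qed
  then have "(\<Sum>j\<in>UNIV. dual_vec A (c *s z) $ j * cnj ((c *s z) $ j))
      = inverse c ^ 3 * cnj c * (\<Sum>j\<in>UNIV. dual_vec A z $ j * cnj (z $ j))"
    by (simp add: sum_distrib_left mult_ac)
  moreover have "(\<Sum>j\<in>UNIV. (c *s z) $ j * cnj ((c *s z) $ j))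
      = c * cnj c * (\<Sum>j\<in>UNIV. z $ j * cnj (z $ j))"
    by (simp add: sum_distrib_left mult_ac)
  ultimately have "radial_factor A (c *s z) = (inverse c ^ 3 * cnj c) / (c * cnj c) * radial_factor A z"
    by (simp only: radial_factor_def times_divide_times_eq)
  also have "(inverse c ^ 3 * cnj c) / (c * cnj c) = inverse c ^ 4"
    using \<open>c \<noteq> 0\<close> by (simp add: field_simps eval_nat_numeral)
  finally show ?thesis .
qed

theorem theorem4p3:
  fixes A :: "4 \<Rightarrow> complex^'k^'k"
  assumes "CARD('k) \<ge> 2"
  shows "\<exists>p :: complex^4 \<Rightarrow> complex.
           homogeneous_of_degree (2 * CARD('k) - 4) p \<and>
           (\<forall>z \<in> projective_resolvent A. \<forall>v.
              tr_omega_cubed A z v = 3 * p z / (det (pencil A z))\<^sup>2 * s_form z v)"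
proof (intro exI conjI ballI allI)
  let ?p = "\<lambda>z. radial_factor A z * (det (pencil A z))\<^sup>2"
  show "homogeneous_of_degree (2 * CARD('k) - 4) ?p"
    unfolding homogeneous_of_degree_def
  proof (intro allI impI)
    fix c :: complex and z :: "complex^4"
    assume "c \<noteq> 0"
    have det: "det (pencil A (c *s z)) = c ^ CARD('k) * det (pencil A z)"
      by (simp add: pencil_scale det_mat_scale)
    show "?p (c *s z) = c ^ (2 * CARD('k) - 4) * ?p z"
    proof (cases "invertible (pencil A z)")
      case True
      have "c ^ (2 * CARD('k)) = c ^ (2 * CARD('k) - 4) * c ^ 4"
        using assms by (simp flip: power_add)
      then have "inverse c ^ 4 * (c ^ CARD('k))\<^sup>2 = c ^ (2 * CARD('k) - 4)"
        using \<open>c \<noteq> 0\<close> by (simp add: field_simps flip: power_mult)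
      then show ?thesis
        by (simp add: radial_factor_scale[OF True \<open>c \<noteq> 0\<close>] det power_mult_distrib mult_ac)
    next
      (* At a singular z the determinant makes both sides vanish. *)
      case False
      then show ?thesis
        by (simp add: det invertible_det_nz)
    qed
  qed
  fix z v
  assume "z \<in> projective_resolvent A"
  then have inv: "invertible (pencil A z)"
    by (simp add: projective_resolvent_def)
  then show "tr_omega_cubed A z v = 3 * ?p z / (det (pencil A z))\<^sup>2 * s_form z v"
    using tr_omega_cubed_eq_radial_factor[OF inv] by (simp add: invertible_det_nz)
qed

end
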